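(* Let $n$ be a positive integer. There exists a complete set of mutually orthogonal Latin squares of order $n$ if and only if $\bar{R}(n+1;n+1)=n^2+1$.
   Context: A complete set of mutually orthogonal Latin squares (MOLS) of order $n$ is a set of $n-1$ pairwise orthogonal Latin squares of order $n$; equivalently, an edge-coloring $f$ of $K_{n^2}$ with $n+1$ colors such that each color class $f^{-1}(i)$ is isomorphic to $nK_n$ (disjoint union of $n$ copies of $K_n$). For a positive integer $N$, $[N]=\{1,\dots,N\}$. An edge-coloring of $K_N$ with $k$ colors is a map $f:\binom{[N]}{2}\to[k]$; $\alpha_i(f)$ is the independence number of the graph on $[N]$ whose edges are the pairs of color $i$. For positive integers $m_1,\dots,m_k$, $\bar{R}(m_1,\dots,m_k)$ is the least positive integer $N$ such that every edge-coloring $f$ of $K_N$ with $k$ colors has some $i\in[k]$ with $\alpha_i(f)\ge m_i$; $\bar{R}(m;k)$ denotes $\bar{R}(m,\dots,m)$ with $k$ arguments. *)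

theory Defs
  imports "HOL-Library.Ramsey" "HOL-Library.FuncSet"
begin

definition latin_square :: "nat \<Rightarrow> (nat \<times> nat \<Rightarrow> nat) \<Rightarrow> bool" where
  "latin_square n L \<longleftrightarrow>
     L \<in> {1..n} \<times> {1..n} \<rightarrow>\<^sub>E {1..n} \<and>
     (\<forall>r\<in>{1..n}. bij_betw (\<lambda>c. L (r, c)) {1..n} {1..n}) \<and>
     (\<forall>c\<in>{1..n}. bij_betw (\<lambda>r. L (r, c)) {1..n} {1..n})"

definition orthogonal_squares :: "nat \<Rightarrow> (nat \<times> nat \<Rightarrow> nat) \<Rightarrow> (nat \<times> nat \<Rightarrow> nat) \<Rightarrow> bool" where
  "orthogonal_squares n L M \<longleftrightarrow>
     bij_betw (\<lambda>p. (L p, M p)) ({1..n} \<times> {1..n}) ({1..n} \<times> {1..n})"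

text \<open>The finiteness condition matters for \<open>n = 1\<close>, as infinite sets have cardinality \<open>0\<close>.\<close>

definition complete_MOLS :: "nat \<Rightarrow> (nat \<times> nat \<Rightarrow> nat) set \<Rightarrow> bool" where
  "complete_MOLS n S \<longleftrightarrow>
     finite S \<and> card S = n - 1 \<and> (\<forall>L\<in>S. latin_square n L) \<and> pairwise (orthogonal_squares n) S"

definition independence_number :: "'a set \<Rightarrow> 'a set set \<Rightarrow> nat" where
  "independence_number V E = Max (card ` {S. S \<subseteq> V \<and> indep S E})"

definition edge_coloring :: "nat \<Rightarrow> nat \<Rightarrow> (nat set \<Rightarrow> nat) \<Rightarrow> bool" where
  "edge_coloring N k f \<longleftrightarrow> f \<in> [{1..N}]\<^bsup>2\<^esup> \<rightarrow> {1..k}"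

definition color_alpha :: "nat \<Rightarrow> (nat set \<Rightarrow> nat) \<Rightarrow> nat \<Rightarrow> nat" where
  "color_alpha N f i = independence_number {1..N} {e \<in> [{1..N}]\<^bsup>2\<^esup>. f e = i}"

text \<open>The parameters \<open>m\<^sub>1, \<dots>, m\<^sub>k\<close> are the values \<open>m 1, \<dots>, m k\<close> of a function.
  For \<open>k \<ge> 2\<close> a suitable \<open>N\<close> exists by Ramsey's theorem, since a clique in one color is
  independent in every other color.\<close>

definition Rbar :: "nat \<Rightarrow> (nat \<Rightarrow> nat) \<Rightarrow> nat" where
  "Rbar k m = (LEAST N. 0 < N \<and>
     (\<forall>f. edge_coloring N k f \<longrightarrow> (\<exists>i\<in>{1..k}. m i \<le> color_alpha N f i)))"

definition Rbar_diag :: "nat \<Rightarrow> nat \<Rightarrow> nat" where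
  "Rbar_diag m k = Rbar k (\<lambda>_. m)"

end

theory Submission
  imports Defs
begin

text \<open>Suppose that all \<open>n + 1\<close> color classes of an edge-coloring of \<open>K\<^sub>N\<close> have independence number at
  most \<open>n\<close>. Turan's theorem bounds the number of edges of each class from below, and summing over
  the classes gives \<open>N \<le> n\<^sup>2\<close>. For \<open>N = n\<^sup>2\<close> all these bounds are attained, so every class is a
  disjoint union of at most \<open>n\<close> cliques. Numbering the cliques of each class gives \<open>n + 1\<close> labels for
  each vertex, and two vertices share the label of at most one class. Such a labelling is the same as
  a complete set of MOLS: two of the labels serve as row and column, and the others are the entries
  of the squares.\<close>

subsection \<open>Independence numbers and Turan's theorem\<close>

lemma independence_number_le_iff:
  assumes "finite V"
  shows "independence_number V E \<le> a \<longleftrightarrow> (\<forall>S\<subseteq>V. indep S E \<longrightarrow> card S \<le> a)"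
proof -
  have "{} \<in> {S. S \<subseteq> V \<and> indep S E}" by simp
  then have "card ` {S. S \<subseteq> V \<and> indep S E} \<noteq> {}" by blast
  with assms show ?thesis
    unfolding independence_number_def by (subst Max_le_iff) auto
qed

lemma independence_number_mono:
  assumes "finite V" "W \<subseteq> V"
  shows "independence_number W E \<le> independence_number V E"
proof -
  have "finite W" using assms finite_subset by blast
  moreover have "card S \<le> independence_number V E" if "S \<subseteq> W" "indep S E" for S
    using independence_number_le_iff[OF assms(1), of E "independence_number V E"] assms(2) that
    by auto
  ultimately show ?thesis by (simp add: independence_number_le_iff)
qed

lemma indep_extend_maximal:
  assumes "finite V" "J \<subseteq> V" "indep J E"
  obtains I where "J \<subseteq> I" "I \<subseteq> V" "indep I E" "\<And>y. y \<in> V - I \<Longrightarrow> \<exists>x\<in>I. {x, y} \<in> E"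
proof -
  let ?F = "{I. I \<subseteq> V \<and> indep I E}"
  have "finite ?F" "J \<in> ?F" using assms by simp_all
  then obtain I where I: "I \<in> ?F" "J \<subseteq> I" and maximal: "\<forall>K\<in>?F. I \<subseteq> K \<longrightarrow> I = K"
    using finite_has_maximal2[of ?F J] by blast
  have "\<exists>x\<in>I. {x, y} \<in> E" if y: "y \<in> V - I" for y
  proof (rule ccontr)
    assume "\<not> ?thesis"
    then have "insert y I \<in> ?F"
      using I(1) y unfolding indep_def by (auto simp: insert_commute)
    with maximal y show False by blast
  qed
  with I that show thesis by blast
qed

lemma one_le_card_neighbours:
  assumes "finite I" "\<exists>x\<in>I. {x, y} \<in> E"
  shows "1 \<le> card {x \<in> I. {x, y} \<in> E}"
  using assms by (auto simp: Suc_le_eq card_gt_0_iff)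

lemma sum_card_neighbours_le_card_edges:
  assumes "finite V" "I \<subseteq> V"
  shows "card (E \<inter> [V - I]\<^bsup>2\<^esup>) + (\<Sum>y\<in>V - I. card {x \<in> I. {x, y} \<in> E}) \<le> card (E \<inter> [V]\<^bsup>2\<^esup>)"
proof -
  let ?inner = "E \<inter> [V - I]\<^bsup>2\<^esup>"
  let ?cross = "SIGMA y:V - I. {x \<in> I. {x, y} \<in> E}"
  let ?edge = "\<lambda>(y, x). {x, y}"
  have fin: "finite I" "finite (E \<inter> [V]\<^bsup>2\<^esup>)"
    using assms finite_subset by (auto intro: finite_imp_finite_nsets)
  have "inj_on ?edge ?cross"
    by (auto simp: inj_on_def doubleton_eq_iff)
  then have "(\<Sum>y\<in>V - I. card {x \<in> I. {x, y} \<in> E}) = card (?edge ` ?cross)"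
    using assms fin by (simp add: card_image)
  moreover have "?inner \<inter> ?edge ` ?cross = {}"
    by (auto simp: nsets_def)
  moreover have "?inner \<union> ?edge ` ?cross \<subseteq> E \<inter> [V]\<^bsup>2\<^esup>"
    using assms(2) nsets_mono[of "V - I" V 2] by auto
  ultimately show ?thesis
    using fin by (metis (no_types, lifting) card_Un_disjoint card_mono finite_Un finite_subset)
qed

lemma turan_bound_remove:
  assumes "finite V" "I \<subseteq> V" "card I \<le> a"
    and rest: "(card (V - I))\<^sup>2 \<le> a * (card (V - I) + 2 * card (E \<inter> [V - I]\<^bsup>2\<^esup>))"
  shows "(card V)\<^sup>2 + 2 * a * (\<Sum>y\<in>V - I. card {x \<in> I. {x, y} \<in> E})
    \<le> a * (card V + 2 * card (E \<inter> [V]\<^bsup>2\<^esup>)) + 2 * a * card (V - I)"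
proof -
  define W b s e where "W = card (V - I)" and "b = card I"
    and "s = (\<Sum>y\<in>V - I. card {x \<in> I. {x, y} \<in> E})" and "e = card (E \<inter> [V - I]\<^bsup>2\<^esup>)"
  have card_V: "card V = W + b"
    using assms(1,2) finite_subset[OF assms(2,1)]
    by (simp add: W_def b_def card_Diff_subset card_mono)
  have "(card V)\<^sup>2 = W\<^sup>2 + 2 * (W * b) + b * b"
    by (simp add: card_V power2_eq_square algebra_simps)
  also have "\<dots> \<le> a * (W + 2 * e) + 2 * (W * a) + a * b"
    using rest assms(3)
    by (intro add_mono mult_le_mono order_refl) (simp_all add: W_def b_def e_def)
  finally have "(card V)\<^sup>2 + 2 * a * s \<le> a * (card V + 2 * (e + s)) + 2 * a * W"
    by (simp add: card_V algebra_simps)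
  also have "\<dots> \<le> a * (card V + 2 * card (E \<inter> [V]\<^bsup>2\<^esup>)) + 2 * a * W"
    using sum_card_neighbours_le_card_edges[OF assms(1,2), of E]
    by (intro add_right_mono mult_le_mono2) (simp add: e_def s_def)
  finally show ?thesis by (simp add: W_def s_def)
qed

lemma turan_bound:
  assumes "finite V" "independence_number V E \<le> a"
  shows "(card V)\<^sup>2 \<le> a * (card V + 2 * card (E \<inter> [V]\<^bsup>2\<^esup>))"
  using assms
proof (induction V rule: finite_psubset_induct)
  case (psubset V)
  show ?case
  proof (cases "V = {}")
    case True
    then show ?thesis by simp
  next
    case False
    then obtain v where v: "v \<in> V" by blast
    obtain I where I: "{v} \<subseteq> I" "I \<subseteq> V" "indep I E"
      and maximal: "\<And>y. y \<in> V - I \<Longrightarrow> \<exists>x\<in>I. {x, y} \<in> E"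
      using indep_extend_maximal[of V "{v}" E] psubset.hyps v by (auto simp: indep_def)
    have finI: "finite I" using I(2) psubset.hyps finite_subset by blast
    have rest: "(card (V - I))\<^sup>2 \<le> a * (card (V - I) + 2 * card (E \<inter> [V - I]\<^bsup>2\<^esup>))"
    proof (rule psubset.IH)
      show "V - I \<subset> V" using I(1) v by blast
      show "independence_number (V - I) E \<le> a"
        using independence_number_mono[OF psubset.hyps Diff_subset] psubset.prems
        by (rule le_trans)
    qed
    have "(\<Sum>y\<in>V - I. 1) \<le> (\<Sum>y\<in>V - I. card {x \<in> I. {x, y} \<in> E})"
      by (intro sum_mono one_le_card_neighbours finI maximal)
    then have "card (V - I) \<le> (\<Sum>y\<in>V - I. card {x \<in> I. {x, y} \<in> E})" by simp
    then have "2 * a * card (V - I) \<le> 2 * a * (\<Sum>y\<in>V - I. card {x \<in> I. {x, y} \<in> E})"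
      by (rule mult_le_mono2)
    moreover have "card I \<le> a"
      using I psubset.hyps psubset.prems by (simp add: independence_number_le_iff)
    ultimately show ?thesis
      using turan_bound_remove[OF psubset.hyps I(2) _ rest] by linarith
  qed
qed

definition cluster_graph :: "'a set \<Rightarrow> 'a set set \<Rightarrow> bool" where
  "cluster_graph V E \<longleftrightarrow>
     (\<forall>x\<in>V. \<forall>y\<in>V. \<forall>z\<in>V. {x, y} \<in> E \<longrightarrow> {y, z} \<in> E \<longrightarrow> x \<noteq> z \<longrightarrow> {x, z} \<in> E)"

text \<open>A vertex \<open>y\<close> adjacent to two nonadjacent vertices \<open>x\<close> and \<open>z\<close> has two neighbours in a maximal
  independent set containing \<open>x\<close> and \<open>z\<close>, and this makes the estimate in the Turan bound strict.\<close>

lemma turan_equality_cluster_graph: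
  assumes fin: "finite V" and alpha: "independence_number V E \<le> a"
    and eq: "(card V)\<^sup>2 = a * (card V + 2 * card (E \<inter> [V]\<^bsup>2\<^esup>))"
  shows "cluster_graph V E"
  unfolding cluster_graph_def
proof (intro ballI impI, rule ccontr)
  fix x y z
  assume xyz: "x \<in> V" "y \<in> V" "z \<in> V"
    and edges: "{x, y} \<in> E" "{y, z} \<in> E" "x \<noteq> z" "{x, z} \<notin> E"
  obtain I where I: "{x, z} \<subseteq> I" "I \<subseteq> V" "indep I E"
    and maximal: "\<And>y. y \<in> V - I \<Longrightarrow> \<exists>x\<in>I. {x, y} \<in> E"
    using indep_extend_maximal[of V "{x, z}" E] fin xyz edges
    by (auto simp: indep_def insert_commute)
  have finI: "finite I" using I(2) fin finite_subset by blast
  have "y \<notin> I" using I(1,3) edges unfolding indep_def by (metis insert_subset)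
  let ?d = "\<lambda>y. card {x \<in> I. {x, y} \<in> E}"
  have "card {x, z} \<le> ?d y"
    using I(1) edges finI by (intro card_mono) (auto simp: insert_commute)
  then have "1 < ?d y" using edges(3) by simp
  then have "(\<Sum>u\<in>V - I. 1) < (\<Sum>u\<in>V - I. ?d u)"
    using fin xyz(2) \<open>y \<notin> I\<close>
    by (intro sum_strict_mono_ex1 ballI one_le_card_neighbours finI maximal) auto
  then have excess: "card (V - I) < (\<Sum>u\<in>V - I. ?d u)" by simp
  have cardI: "card I \<le> a"
    using I fin alpha by (simp add: independence_number_le_iff)
  have "0 < card I" using I(1) finI by (auto simp: card_gt_0_iff)
  with cardI excess have "2 * a * card (V - I) < 2 * a * (\<Sum>u\<in>V - I. ?d u)" by simp
  moreover have "independence_number (V - I) E \<le> a"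
    using independence_number_mono[OF fin Diff_subset] alpha by (rule le_trans)
  then have "(card (V - I))\<^sup>2 \<le> a * (card (V - I) + 2 * card (E \<inter> [V - I]\<^bsup>2\<^esup>))"
    using fin by (intro turan_bound) auto
  ultimately show False
    using turan_bound_remove[OF fin I(2) cardI] eq by fastforce
qed

subsection \<open>Clique labellings\<close>

definition clique_labelling :: "'a set \<Rightarrow> 'a set set \<Rightarrow> 'b set \<Rightarrow> ('a \<Rightarrow> 'b) \<Rightarrow> bool" where
  "clique_labelling V E B g \<longleftrightarrow> g \<in> V \<rightarrow> B \<and> (\<forall>b\<in>B. clique {x \<in> V. g x = b} E)"

lemma independence_number_le_clique_labelling:
  assumes "finite V" "finite B" and g: "clique_labelling V E B g"
  shows "independence_number V E \<le> card B"
proof -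
  have "card S \<le> card B" if S: "S \<subseteq> V" "indep S E" for S
  proof (rule card_inj_on_le)
    show "g ` S \<subseteq> B" using g S(1) unfolding clique_labelling_def by blast
    show "inj_on g S"
    proof (rule inj_onI, rule ccontr)
      fix x y assume xy: "x \<in> S" "y \<in> S" "g x = g y" "x \<noteq> y"
      then have "{x, y} \<in> E"
        using g S(1) unfolding clique_labelling_def clique_def by blast
      then show False using S(2) xy unfolding indep_def by blast
    qed
  qed fact
  then show ?thesis using assms(1) by (simp add: independence_number_le_iff)
qed

lemma cluster_graph_clique_labelling:
  assumes fin: "finite V" "finite B" and cluster: "cluster_graph V E"
    and alpha: "independence_number V E \<le> card B"
  obtains g where "clique_labelling V E B g"
proof -
  obtain I where I: "I \<subseteq> V" "indep I E"
    and maximal: "\<And>y. y \<in> V - I \<Longrightarrow> \<exists>x\<in>I. {x, y} \<in> E"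
    using indep_extend_maximal[of V "{}" E] fin(1) by auto
  then have "\<forall>y\<in>V. \<exists>x\<in>I. x = y \<or> {x, y} \<in> E" by blast
  then obtain rep where rep: "\<And>y. y \<in> V \<Longrightarrow> rep y \<in> I \<and> (rep y = y \<or> {rep y, y} \<in> E)"
    by metis
  have "finite I" "card I \<le> card B"
    using I fin(1) alpha finite_subset by (auto simp: independence_number_le_iff)
  then obtain h where h: "h ` I \<subseteq> B" "inj_on h I"
    using card_le_inj[of I B] fin(2) by blast
  have "{x, y} \<in> E" if xy: "x \<in> V" "y \<in> V" "h (rep x) = h (rep y)" "x \<noteq> y" for x y
  proof -
    have "rep x = rep y" using h(2) rep xy by (meson inj_onD)
    then have "rep x = x \<or> {x, rep x} \<in> E" "rep x = y \<or> {rep x, y} \<in> E"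
      using rep[OF xy(1)] rep[OF xy(2)] by (auto simp: insert_commute)
    moreover have "rep x \<in> V" using rep xy(1) I(1) by blast
    ultimately show ?thesis
      using xy cluster unfolding cluster_graph_def by metis
  qed
  moreover have "(\<lambda>x. h (rep x)) \<in> V \<rightarrow> B" using h rep by blast
  ultimately have "clique_labelling V E B (\<lambda>x. h (rep x))"
    unfolding clique_labelling_def clique_def by auto
  then show thesis by (rule that)
qed

subsection \<open>Colorings with small independence numbers\<close>

definition color_class :: "'a set \<Rightarrow> ('a set \<Rightarrow> 'i) \<Rightarrow> 'i \<Rightarrow> 'a set set" where
  "color_class V f i = {e \<in> [V]\<^bsup>2\<^esup>. f e = i}"

lemma color_class_Int_nsets: "color_class V f i \<inter> [V]\<^bsup>2\<^esup> = color_class V f i"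
  by (auto simp: color_class_def)

definition alpha_bounded_coloring :: "'i set \<Rightarrow> 'a set \<Rightarrow> nat \<Rightarrow> ('a set \<Rightarrow> 'i) \<Rightarrow> bool" where
  "alpha_bounded_coloring K V a f \<longleftrightarrow>
     f \<in> [V]\<^bsup>2\<^esup> \<rightarrow> K \<and> (\<forall>i\<in>K. independence_number V (color_class V f i) \<le> a)"

lemma alpha_bounded_coloring_subset:
  assumes f: "alpha_bounded_coloring K W a f" and "V \<subseteq> W" "finite W"
  shows "alpha_bounded_coloring K V a f"
proof -
  have "indep S (color_class V f i) \<longleftrightarrow> indep S (color_class W f i)" if "S \<subseteq> V" for S i
    using that \<open>V \<subseteq> W\<close> unfolding indep_def color_class_def by (auto simp: subset_iff)
  moreover have "finite V" using assms finite_subset by blast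
  moreover have "f \<in> [V]\<^bsup>2\<^esup> \<rightarrow> K"
    using f nsets_mono[OF \<open>V \<subseteq> W\<close>, of 2] unfolding alpha_bounded_coloring_def by blast
  ultimately show ?thesis
    using assms unfolding alpha_bounded_coloring_def by (auto simp: independence_number_le_iff)
qed

lemma sum_turan_bounds:
  assumes "finite V" "finite K" "f \<in> [V]\<^bsup>2\<^esup> \<rightarrow> K"
  shows "(\<Sum>i\<in>K. a * (card V + 2 * card (color_class V f i)))
    = card V * (a * (card K + card V - 1))"
proof -
  have "(\<Sum>i\<in>K. card (color_class V f i)) = card ([V]\<^bsup>2\<^esup>)"
    using assms sum.group[of "[V]\<^bsup>2\<^esup>" K f "\<lambda>_. 1 :: nat"]
    by (simp add: color_class_def finite_imp_finite_nsets image_subset_iff_funcset)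
  moreover have "even (card V * (card V - 1))" by auto
  ultimately have "2 * (\<Sum>i\<in>K. card (color_class V f i)) = card V * (card V - 1)"
    by (simp add: choose_two)
  then have "(\<Sum>i\<in>K. card V + 2 * card (color_class V f i))
      = card K * card V + card V * (card V - 1)"
    by (simp add: sum.distrib flip: sum_distrib_left)
  also have "\<dots> = card V * (card K + card V - 1)"
    by (cases "card V") (simp_all add: algebra_simps)
  finally show ?thesis by (simp flip: sum_distrib_left)
qed

lemma alpha_bounded_color_class_turan_bound:
  assumes "finite V" "alpha_bounded_coloring K V a f" "i \<in> K"
  shows "(card V)\<^sup>2 \<le> a * (card V + 2 * card (color_class V f i))"
  using turan_bound[of V "color_class V f i" a] assms
  by (simp add: alpha_bounded_coloring_def color_class_Int_nsets)

lemma alpha_bounded_coloring_card_le: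
  assumes fin: "finite V" "finite K" "V \<noteq> {}" and f: "alpha_bounded_coloring K V a f"
  shows "card K * card V \<le> a * (card K + card V - 1)"
proof -
  have "card V * (card K * card V) = (\<Sum>i\<in>K. (card V)\<^sup>2)"
    by (simp add: power2_eq_square)
  also have "\<dots> \<le> (\<Sum>i\<in>K. a * (card V + 2 * card (color_class V f i)))"
    by (intro sum_mono alpha_bounded_color_class_turan_bound[OF fin(1) f])
  also have "\<dots> = card V * (a * (card K + card V - 1))"
    using fin f by (simp add: sum_turan_bounds alpha_bounded_coloring_def)
  finally show ?thesis using fin by (simp add: card_gt_0_iff)
qed

lemma extremal_color_class_cluster_graph:
  assumes fin: "finite V" "finite K" and f: "alpha_bounded_coloring K V a f"
    and extremal: "card K * card V = a * (card K + card V - 1)" and "i \<in> K"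
  shows "cluster_graph V (color_class V f i)"
proof -
  have "(\<Sum>i\<in>K. (card V)\<^sup>2) = card V * (card K * card V)"
    by (simp add: power2_eq_square)
  also have "\<dots> = (\<Sum>i\<in>K. a * (card V + 2 * card (color_class V f i)))"
    using fin f extremal by (simp add: sum_turan_bounds alpha_bounded_coloring_def)
  finally have "(card V)\<^sup>2 = a * (card V + 2 * card (color_class V f i))"
    using alpha_bounded_color_class_turan_bound[OF fin(1) f] \<open>i \<in> K\<close> fin(2)
    by (rule sum_mono_inv)
  then show ?thesis
    using turan_equality_cluster_graph[of V "color_class V f i" a] fin(1) f \<open>i \<in> K\<close>
    by (simp add: alpha_bounded_coloring_def color_class_Int_nsets)
qed

subsection \<open>Orthogonal labellings\<close>

definition orthogonal_labelling :: "'i set \<Rightarrow> 'a set \<Rightarrow> 'b set \<Rightarrow> ('i \<Rightarrow> 'a \<Rightarrow> 'b) \<Rightarrow> bool" where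
  "orthogonal_labelling K V B g \<longleftrightarrow>
     (\<forall>i\<in>K. g i \<in> V \<rightarrow> B) \<and> pairwise (\<lambda>i j. inj_on (\<lambda>x. (g i x, g j x)) V) K"

lemma orthogonal_labelling_of_clique_labellings:
  assumes "\<And>i. i \<in> K \<Longrightarrow> clique_labelling V (color_class V f i) B (g i)"
  shows "orthogonal_labelling K V B g"
proof -
  have f_eq: "f {x, y} = i"
    if "i \<in> K" "x \<in> V" "y \<in> V" "g i x = g i y" "x \<noteq> y" for i x y
    using assms[OF that(1)] that(2-) unfolding clique_labelling_def clique_def color_class_def
    by blast
  have "inj_on (\<lambda>x. (g i x, g j x)) V" if "i \<in> K" "j \<in> K" "i \<noteq> j" for i j
    using f_eq[OF that(1)] f_eq[OF that(2)] that(3) by (intro inj_onI) blast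
  then show ?thesis
    using assms unfolding orthogonal_labelling_def pairwise_def clique_labelling_def by blast
qed

lemma coloring_of_orthogonal_labelling:
  assumes g: "orthogonal_labelling K V B g" and "K \<noteq> {}"
  obtains f where "f \<in> [V]\<^bsup>2\<^esup> \<rightarrow> K" "\<And>i. i \<in> K \<Longrightarrow> clique_labelling V (color_class V f i) B (g i)"
proof -
  have "\<exists>i\<in>K. \<forall>j\<in>K. (\<forall>x\<in>e. \<forall>y\<in>e. g j x = g j y) \<longrightarrow> j = i" if e: "e \<in> [V]\<^bsup>2\<^esup>" for e
  proof -
    obtain x y where xy: "e = {x, y}" "x \<in> V" "y \<in> V" "x \<noteq> y" using e by (rule nsets2_E)
    have "i = j" if "i \<in> K" "j \<in> K" "g i x = g i y" "g j x = g j y" for i j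
      using g that xy(2-) unfolding orthogonal_labelling_def pairwise_def inj_on_def by blast
    then show ?thesis using \<open>K \<noteq> {}\<close> xy(1) by (metis insertI1 insertI2 ex_in_conv)
  qed
  then obtain f where f: "f \<in> [V]\<^bsup>2\<^esup> \<rightarrow> K"
    and f_eq: "\<And>e j. \<lbrakk>e \<in> [V]\<^bsup>2\<^esup>; j \<in> K; \<forall>x\<in>e. \<forall>y\<in>e. g j x = g j y\<rbrakk> \<Longrightarrow> f e = j"
    by (metis (no_types, lifting) Pi_I)
  have "clique_labelling V (color_class V f i) B (g i)" if i: "i \<in> K" for i
    using g i f_eq[OF _ i]
    unfolding orthogonal_labelling_def clique_labelling_def clique_def color_class_def by auto
  with f show thesis by (rule that)
qed

lemma alpha_bounded_coloring_iff_orthogonal_labelling: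
  assumes fin: "finite V" "finite B" "finite K"
    and card: "card K = card B + 1" "card V = (card B)\<^sup>2"
  shows "(\<exists>f. alpha_bounded_coloring K V (card B) f) \<longleftrightarrow> (\<exists>g. orthogonal_labelling K V B g)"
proof
  assume "\<exists>f. alpha_bounded_coloring K V (card B) f"
  then obtain f where f: "alpha_bounded_coloring K V (card B) f" by blast
  have "card K * card V = card B * (card K + card V - 1)"
    by (simp add: card power2_eq_square algebra_simps)
  then have "\<exists>g. clique_labelling V (color_class V f i) B g" if "i \<in> K" for i
    using extremal_color_class_cluster_graph[OF fin(1,3) f _ that] f that
    by (metis alpha_bounded_coloring_def cluster_graph_clique_labelling fin(1,2))
  then obtain g where "\<And>i. i \<in> K \<Longrightarrow> clique_labelling V (color_class V f i) B (g i)"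
    by metis
  then show "\<exists>g. orthogonal_labelling K V B g"
    using orthogonal_labelling_of_clique_labellings by blast
next
  assume "\<exists>g. orthogonal_labelling K V B g"
  then obtain g where g: "orthogonal_labelling K V B g" by blast
  have "K \<noteq> {}" using card(1) by auto
  then obtain f where "f \<in> [V]\<^bsup>2\<^esup> \<rightarrow> K"
    "\<And>i. i \<in> K \<Longrightarrow> clique_labelling V (color_class V f i) B (g i)"
    using coloring_of_orthogonal_labelling[OF g] by metis
  then show "\<exists>f. alpha_bounded_coloring K V (card B) f"
    unfolding alpha_bounded_coloring_def
    using independence_number_le_clique_labelling[OF fin(1,2)] by blast
qed

lemma orthogonal_labelling_comp:
  assumes g: "orthogonal_labelling K V B g" and h: "bij_betw h W V"
  shows "orthogonal_labelling K W B (\<lambda>i. g i \<circ> h)"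
proof -
  have "inj_on (\<lambda>x. (g i (h x), g j (h x))) W" if "inj_on (\<lambda>x. (g i x, g j x)) V" for i j
    using comp_inj_on[of h W "\<lambda>x. (g i x, g j x)"] h that
    unfolding bij_betw_def by (simp add: comp_def)
  moreover have "g i \<circ> h \<in> W \<rightarrow> B" if "g i \<in> V \<rightarrow> B" for i
    using h that bij_betwE by fastforce
  ultimately show ?thesis
    using g unfolding orthogonal_labelling_def pairwise_def by simp
qed

lemma orthogonal_labelling_coordinates:
  assumes g: "orthogonal_labelling K V B g" and ij: "i \<in> K" "j \<in> K" "i \<noteq> j"
    and "finite B" "card V = (card B)\<^sup>2"
  obtains G where "orthogonal_labelling K (B \<times> B) B G"
    "\<And>p. p \<in> B \<times> B \<Longrightarrow> G i p = fst p" "\<And>p. p \<in> B \<times> B \<Longrightarrow> G j p = snd p"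
proof -
  let ?c = "\<lambda>x. (g i x, g j x)"
  have inj: "inj_on ?c V" and into: "?c ` V \<subseteq> B \<times> B"
    using g ij unfolding orthogonal_labelling_def pairwise_def by blast+
  then have "?c ` V = B \<times> B"
    using assms(5,6) by (intro card_subset_eq) (simp_all add: card_image power2_eq_square)
  with inj have c_bij: "bij_betw ?c V (B \<times> B)" by (simp add: bij_betw_def)
  have c_inv: "?c (inv_into V ?c p) = p" if "p \<in> B \<times> B" for p
    by (rule bij_betw_inv_into_right[OF c_bij that])
  from orthogonal_labelling_comp[OF g bij_betw_inv_into[OF c_bij]] show thesis
  proof (rule that)
    show "(g i \<circ> inv_into V ?c) p = fst p" if "p \<in> B \<times> B" for p
      using arg_cong[OF c_inv[OF that], of fst] by simp
    show "(g j \<circ> inv_into V ?c) p = snd p" if "p \<in> B \<times> B" for p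
      using arg_cong[OF c_inv[OF that], of snd] by simp
  qed
qed

subsection \<open>Complete sets of MOLS as orthogonal labellings\<close>

lemma inj_on_Pair_commute:
  "inj_on (\<lambda>x. (g x, h x)) V \<longleftrightarrow> inj_on (\<lambda>x. (h x, g x)) V"
  by (auto simp: inj_on_def)

lemma orthogonal_squares_iff_inj_on:
  assumes "L \<in> {1..n} \<times> {1..n} \<rightarrow> {1..n}" "M \<in> {1..n} \<times> {1..n} \<rightarrow> {1..n}"
  shows "orthogonal_squares n L M \<longleftrightarrow> inj_on (\<lambda>p. (L p, M p)) ({1..n} \<times> {1..n})"
proof -
  let ?B = "{1..n} \<times> {1..n}"
  have "(\<lambda>p. (L p, M p)) ` ?B \<subseteq> ?B" using assms by fast
  then show ?thesis
    unfolding orthogonal_squares_def bij_betw_def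
    using endo_inj_surj[of ?B "\<lambda>p. (L p, M p)"] by auto
qed

lemma latin_square_iff_inj_on:
  "latin_square n L \<longleftrightarrow>
     L \<in> {1..n} \<times> {1..n} \<rightarrow>\<^sub>E {1..n} \<and>
     inj_on (\<lambda>p. (fst p, L p)) ({1..n} \<times> {1..n}) \<and>
     inj_on (\<lambda>p. (snd p, L p)) ({1..n} \<times> {1..n})"
proof (cases "L \<in> {1..n} \<times> {1..n} \<rightarrow>\<^sub>E {1..n}")
  case True
  have bij_iff: "bij_betw h {1..n} {1..n} \<longleftrightarrow> inj_on h {1..n}" if "h ` {1..n} \<subseteq> {1..n}" for h
    using endo_inj_surj[of "{1..n}" h] that by (auto simp: bij_betw_def)
  have "(\<forall>r\<in>{1..n}. bij_betw (\<lambda>c. L (r, c)) {1..n} {1..n})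
      \<longleftrightarrow> (\<forall>r\<in>{1..n}. inj_on (\<lambda>c. L (r, c)) {1..n})"
    by (intro ball_cong[OF refl] bij_iff image_subsetI PiE_mem[OF True]) simp
  also have "\<dots> \<longleftrightarrow> inj_on (\<lambda>p. (fst p, L p)) ({1..n} \<times> {1..n})"
    by (auto simp: inj_on_def)
  finally have rows: "(\<forall>r\<in>{1..n}. bij_betw (\<lambda>c. L (r, c)) {1..n} {1..n})
      \<longleftrightarrow> inj_on (\<lambda>p. (fst p, L p)) ({1..n} \<times> {1..n})" .
  have "(\<forall>c\<in>{1..n}. bij_betw (\<lambda>r. L (r, c)) {1..n} {1..n})
      \<longleftrightarrow> (\<forall>c\<in>{1..n}. inj_on (\<lambda>r. L (r, c)) {1..n})"
    by (intro ball_cong[OF refl] bij_iff image_subsetI PiE_mem[OF True]) simp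
  also have "\<dots> \<longleftrightarrow> inj_on (\<lambda>p. (snd p, L p)) ({1..n} \<times> {1..n})"
    by (auto simp: inj_on_def)
  finally show ?thesis
    using True rows by (simp only: latin_square_def)
qed (simp add: latin_square_def)

lemma not_orthogonal_squares_self:
  assumes "2 \<le> n"
  shows "\<not> orthogonal_squares n L L"
proof
  assume "orthogonal_squares n L L"
  then have "(1, 2) \<in> (\<lambda>p. (L p, L p)) ` ({1..n} \<times> {1..n})"
    using assms unfolding orthogonal_squares_def bij_betw_def by auto
  then show False by auto
qed

lemma complete_MOLS_image:
  assumes "finite I" "card I = n - 1" and latin: "\<And>i. i \<in> I \<Longrightarrow> latin_square n (L i)"
    and orth: "\<And>i j. \<lbrakk>i \<in> I; j \<in> I; i \<noteq> j\<rbrakk> \<Longrightarrow> orthogonal_squares n (L i) (L j)"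
  shows "complete_MOLS n (L ` I)"
proof -
  have "inj_on L I"
  proof (rule inj_onI, rule ccontr)
    fix i j assume ij: "i \<in> I" "j \<in> I" "L i = L j" "i \<noteq> j"
    have "card {i, j} \<le> card I" using ij assms(1) by (intro card_mono) auto
    then have "2 \<le> n" using ij(4) assms(2) by simp
    then show False using orth[OF ij(1,2,4)] ij(3) by (simp add: not_orthogonal_squares_self)
  qed
  then show ?thesis
    using assms by (auto simp: complete_MOLS_def card_image intro: pairwise_imageI)
qed

lemma orthogonal_labelling_of_complete_MOLS:
  assumes "0 < n" and S: "complete_MOLS n S"
  obtains g where "orthogonal_labelling {1..n + 1} ({1..n} \<times> {1..n}) {1..n} g"
proof -
  let ?B = "{1..n} \<times> {1..n}"
  have "card {1..<n} = card S" using S by (simp add: complete_MOLS_def)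
  then obtain h where h: "bij_betw h {1..<n} S"
    using S finite_same_card_bij unfolding complete_MOLS_def by blast
  have latin: "latin_square n (h i)" if "i \<in> {1..<n}" for i
    using S bij_betwE[OF h] that by (simp add: complete_MOLS_def)
  then have into: "h i \<in> ?B \<rightarrow> {1..n}" if "i \<in> {1..<n}" for i
    using that unfolding latin_square_def by blast
  have "orthogonal_squares n (h i) (h j)" if "i \<in> {1..<n}" "j \<in> {1..<n}" "i \<noteq> j" for i j
    using S h that unfolding complete_MOLS_def pairwise_def bij_betw_def inj_on_def by blast
  then have entries: "inj_on (\<lambda>p. (h i p, h j p)) ?B"
    if "i \<in> {1..<n}" "j \<in> {1..<n}" "i \<noteq> j" for i j
    using that into by (simp add: orthogonal_squares_iff_inj_on)
  have coordinates:
    "inj_on (\<lambda>p. (fst p, h i p)) ?B" "inj_on (\<lambda>p. (h i p, fst p)) ?B"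
    "inj_on (\<lambda>p. (snd p, h i p)) ?B" "inj_on (\<lambda>p. (h i p, snd p)) ?B"
    if "i \<in> {1..<n}" for i
    using latin[OF that] inj_on_Pair_commute[of _ "h i" ?B]
    unfolding latin_square_iff_inj_on by blast+
  have fst_snd: "inj_on (\<lambda>p. (fst p, snd p)) ?B" "inj_on (\<lambda>p. (snd p, fst p)) ?B"
    by (auto simp: inj_on_def)
  let ?g = "h(n := fst, n + 1 := snd)"
  have "{1..n + 1} = insert n (insert (n + 1) {1..<n})" using assms(1) by auto
  then have "orthogonal_labelling {1..n + 1} ?B {1..n} ?g"
    using into entries coordinates fst_snd
    by (auto simp: orthogonal_labelling_def pairwise_insert pairwise_def)
  then show thesis by (rule that)
qed

lemma complete_MOLS_of_orthogonal_labelling: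
  assumes "0 < n" and g: "orthogonal_labelling {1..n + 1} V {1..n} g" and "card V = n\<^sup>2"
  shows "\<exists>S. complete_MOLS n S"
proof -
  let ?B = "{1..n} \<times> {1..n}"
  have "n \<in> {1..n + 1}" "n + 1 \<in> {1..n + 1}" "n \<noteq> n + 1" using assms(1) by auto
  then obtain G where G: "orthogonal_labelling {1..n + 1} ?B {1..n} G"
    and coordinates: "\<And>p. p \<in> ?B \<Longrightarrow> G n p = fst p" "\<And>p. p \<in> ?B \<Longrightarrow> G (n + 1) p = snd p"
    using orthogonal_labelling_coordinates[OF g, of n "n + 1"] assms(3) by auto
  define L where "L i = restrict (G i) ?B" for i
  have into: "L i \<in> ?B \<rightarrow>\<^sub>E {1..n}" if "i \<in> {1..<n}" for i
    using G that unfolding orthogonal_labelling_def L_def by (simp add: restrict_PiE_iff)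
  have inj: "inj_on (\<lambda>p. (G i p, G j p)) ?B"
    if "i \<in> {1..n + 1}" "j \<in> {1..n + 1}" "i \<noteq> j" for i j
    using G that unfolding orthogonal_labelling_def pairwise_def by blast
  have latin: "latin_square n (L i)" if i: "i \<in> {1..<n}" for i
  proof -
    have "inj_on (\<lambda>p. (fst p, L i p)) ?B"
      using inj[of n i] i
      by (subst inj_on_cong[of _ _ "\<lambda>p. (G n p, G i p)"]) (simp_all add: coordinates L_def)
    moreover have "inj_on (\<lambda>p. (snd p, L i p)) ?B"
      using inj[of "n + 1" i] i
      by (subst inj_on_cong[of _ _ "\<lambda>p. (G (n + 1) p, G i p)"])
        (simp_all add: coordinates[simplified] L_def)
    ultimately show ?thesis
      using into[OF i] by (simp add: latin_square_iff_inj_on)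
  qed
  have orth: "orthogonal_squares n (L i) (L j)" if "i \<in> {1..<n}" "j \<in> {1..<n}" "i \<noteq> j" for i j
  proof -
    have "inj_on (\<lambda>p. (L i p, L j p)) ?B"
      using inj[of i j] that
      by (subst inj_on_cong[of _ _ "\<lambda>p. (G i p, G j p)"]) (simp_all add: L_def)
    then show ?thesis
      using into that by (subst orthogonal_squares_iff_inj_on) (auto simp: PiE_def)
  qed
  have "complete_MOLS n (L ` {1..<n})"
    using latin orth by (intro complete_MOLS_image) simp_all
  then show ?thesis ..
qed

lemma complete_MOLS_iff_orthogonal_labelling:
  assumes "0 < n" "finite V" "card V = n\<^sup>2"
  shows "(\<exists>S. complete_MOLS n S) \<longleftrightarrow> (\<exists>g. orthogonal_labelling {1..n + 1} V {1..n} g)"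
proof
  assume "\<exists>S. complete_MOLS n S"
  then obtain g where g: "orthogonal_labelling {1..n + 1} ({1..n} \<times> {1..n}) {1..n} g"
    using orthogonal_labelling_of_complete_MOLS[OF assms(1)] by blast
  have "card V = card ({1..n} \<times> {1..n})" using assms(3) by (simp add: power2_eq_square)
  then obtain h where "bij_betw h V ({1..n} \<times> {1..n})"
    using finite_same_card_bij[OF assms(2), of "{1..n} \<times> {1..n}"] by auto
  then show "\<exists>g. orthogonal_labelling {1..n + 1} V {1..n} g"
    using orthogonal_labelling_comp[OF g] by blast
next
  assume "\<exists>g. orthogonal_labelling {1..n + 1} V {1..n} g"
  then show "\<exists>S. complete_MOLS n S"
    using complete_MOLS_of_orthogonal_labelling assms(1,3) by blast
qed

subsection \<open>The Ramsey-type number\<close>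

lemma Rbar_diag_eq_Least:
  "Rbar_diag (a + 1) k =
     (LEAST N. 0 < N \<and> \<not> (\<exists>f. alpha_bounded_coloring {1..k} {1..N} a f))"
proof -
  have "color_alpha N f i = independence_number {1..N} (color_class {1..N} f i)" for N f i
    by (simp add: color_alpha_def color_class_def)
  then show ?thesis
    unfolding Rbar_diag_def Rbar_def edge_coloring_def alpha_bounded_coloring_def
    by (simp add: not_le Suc_le_eq)
qed

lemma Rbar_diag_eq_Suc_iff:
  assumes "0 < N" and none: "\<nexists>f. alpha_bounded_coloring {1..k} {1..N + 1} a f"
  shows "Rbar_diag (a + 1) k = N + 1 \<longleftrightarrow> (\<exists>f. alpha_bounded_coloring {1..k} {1..N} a f)"
  unfolding Rbar_diag_eq_Least
proof
  let ?P = "\<lambda>N. 0 < N \<and> \<not> (\<exists>f. alpha_bounded_coloring {1..k} {1..N} a f)"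
  show "\<exists>f. alpha_bounded_coloring {1..k} {1..N} a f" if "Least ?P = N + 1"
    using not_less_Least[of N ?P] that assms(1) by auto
  show "Least ?P = N + 1" if "\<exists>f. alpha_bounded_coloring {1..k} {1..N} a f"
  proof (rule Least_equality)
    fix M :: nat assume "?P M"
    then have "\<not> {1..M} \<subseteq> {1..N}" using that alpha_bounded_coloring_subset by blast
    then show "N + 1 \<le> M" by auto
  qed (use none in simp)
qed

theorem theorem5p5:
  fixes n :: nat
  assumes "0 < n"
  shows "(\<exists>S. complete_MOLS n S) \<longleftrightarrow> Rbar_diag (n + 1) (n + 1) = n\<^sup>2 + 1"
proof -
  have none: "\<nexists>f. alpha_bounded_coloring {1..n + 1} {1..n\<^sup>2 + 1} n f"
  proof
    assume "\<exists>f. alpha_bounded_coloring {1..n + 1} {1..n\<^sup>2 + 1} n f"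
    then have "(n + 1) * (n\<^sup>2 + 1) \<le> n * (n + 1 + (n\<^sup>2 + 1) - 1)"
      using alpha_bounded_coloring_card_le[of "{1..n\<^sup>2 + 1}" "{1..n + 1}" n] by auto
    then show False by (simp add: power2_eq_square algebra_simps)
  qed
  have "(\<exists>S. complete_MOLS n S) \<longleftrightarrow> (\<exists>g. orthogonal_labelling {1..n + 1} {1..n\<^sup>2} {1..n} g)"
    using assms by (intro complete_MOLS_iff_orthogonal_labelling) simp_all
  also have "\<dots> \<longleftrightarrow> (\<exists>f. alpha_bounded_coloring {1..n + 1} {1..n\<^sup>2} n f)"
    using alpha_bounded_coloring_iff_orthogonal_labelling[of "{1..n\<^sup>2}" "{1..n}" "{1..n + 1}"]
    by simp
  also have "\<dots> \<longleftrightarrow> Rbar_diag (n + 1) (n + 1) = n\<^sup>2 + 1"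
    using assms by (intro Rbar_diag_eq_Suc_iff[symmetric] none) simp
  finally show ?thesis .
qed

end
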